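(* Let $G$ be any graph with stability number $\alpha(G)\leq 2$. Then $\chi(G)\leq \gamma_\ell(G)$, where $\gamma_\ell(G)=\max_{v\in V(G)}\left\lceil \tfrac12\bigl(d(v)+1+\omega(v)\bigr)\right\rceil$.
   Context: $d(v)$ is the degree of $v$ and $\omega(v)$ is the maximum size of a clique containing $v$. *)

theory Defs
  imports Complex_Main "HOL-Library.Ramsey"
begin

text \<open>
  A finite simple graph is a finite vertex set \<open>V\<close> together with a set \<open>E\<close> of 2-element
  subsets of \<open>V\<close>. Cliques and stable sets are \<open>clique\<close> and \<open>indep\<close> from the theory of Ramsey's
  theorem, both of which allow the empty set.
\<close>

definition fin_sgraph :: "'a set \<Rightarrow> 'a set set \<Rightarrow> bool" where
  "fin_sgraph V E \<longleftrightarrow> finite V \<and> E \<subseteq> [V]\<^bsup>2\<^esup>"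

definition degree :: "'a set \<Rightarrow> 'a set set \<Rightarrow> 'a \<Rightarrow> nat" where
  "degree V E v = card {w \<in> V. {v, w} \<in> E}"

definition stability_number :: "'a set \<Rightarrow> 'a set set \<Rightarrow> nat" where
  "stability_number V E = Max {card S | S. S \<subseteq> V \<and> indep S E}"

definition clique_number_at :: "'a set \<Rightarrow> 'a set set \<Rightarrow> 'a \<Rightarrow> nat" where
  "clique_number_at V E v = Max {card K | K. K \<subseteq> V \<and> clique K E \<and> v \<in> K}"

definition proper_coloring :: "'a set \<Rightarrow> 'a set set \<Rightarrow> nat \<Rightarrow> ('a \<Rightarrow> nat) \<Rightarrow> bool" where
  "proper_coloring V E k c \<longleftrightarrow>
     c ` V \<subseteq> {..<k} \<and> (\<forall>u\<in>V. \<forall>v\<in>V. {u, v} \<in> E \<longrightarrow> c u \<noteq> c v)"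

definition chromatic_number :: "'a set \<Rightarrow> 'a set set \<Rightarrow> nat" where
  "chromatic_number V E = (LEAST k. \<exists>c. proper_coloring V E k c)"

text \<open>
  The maximum over the vertices is written as a supremum of natural numbers. For a finite
  nonempty \<open>V\<close> this is the maximum, and for \<open>V = {}\<close> it is \<open>0\<close>.
\<close>

definition gamma_local :: "'a set \<Rightarrow> 'a set set \<Rightarrow> nat" where
  "gamma_local V E =
     (SUP v\<in>V. nat \<lceil>(1/2 :: real) * (real (degree V E v) + 1 + real (clique_number_at V E v))\<rceil>)"

end

theory Submission
  imports Defs
begin

text \<open>
  Let \<open>H\<close> be the complement of \<open>G\<close>, which is triangle-free. A maximum matching \<open>M\<close> of \<open>H\<close> gives a
  colouring of \<open>G\<close> with \<open>|V| - |M|\<close> colours, so it suffices to bound this number. Deleting a vertex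
  covered by every maximum matching lowers \<open>|V|\<close> and \<open>|M|\<close> alike, so one may assume that every
  vertex is missed by some maximum matching. Then, by Gallai's lemma, ``no maximum matching misses
  both \<open>a\<close> and \<open>b\<close>'' is a transitive relation, and it contains the edges of \<open>H\<close>. Let \<open>v\<close> have minimum
  degree in \<open>H\<close>, let \<open>S\<close> be the set of vertices missed by a maximum matching missing \<open>v\<close>, and let \<open>w\<close>
  be an \<open>H\<close>-neighbour of \<open>v\<close>. The \<open>H\<close>-neighbourhood of \<open>w\<close> is a clique of \<open>G\<close> as \<open>H\<close> is triangle-free,
  and together with \<open>S - {v}\<close> it remains one, since different elements of \<open>S\<close> are not related.
  This clique contains \<open>v\<close> and is large enough.
\<close>

section \<open>Matchings and maximum matchings\<close>

definition matching :: "'a set set \<Rightarrow> 'a set set \<Rightarrow> bool" where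
  "matching F M \<longleftrightarrow> M \<subseteq> F \<and> pairwise disjnt M"

definition max_matching :: "'a set set \<Rightarrow> 'a set set \<Rightarrow> bool" where
  "max_matching F M \<longleftrightarrow> matching F M \<and> (\<forall>L. matching F L \<longrightarrow> card L \<le> card M)"

lemma matching_insert:
  assumes "matching F M" "e \<in> F" "e \<inter> \<Union>M = {}"
  shows "matching F (insert e M)"
  using assms unfolding matching_def pairwise_insert disjnt_def by blast

lemma matching_mono: "matching F M \<Longrightarrow> F \<subseteq> F' \<Longrightarrow> matching F' M"
  unfolding matching_def by blast

lemma matching_subset: "matching F M \<Longrightarrow> L \<subseteq> M \<Longrightarrow> matching F L"
  unfolding matching_def by (meson order_trans pairwise_subset)

lemma max_matching_exists:
  assumes "finite F"
  obtains M where "max_matching F M"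
proof -
  have "\<exists>M. matching F M \<and> (\<forall>L. matching F L \<longrightarrow> card L \<le> card M)"
  proof (rule ex_has_greatest_nat)
    show "matching F {}" by (simp add: matching_def)
    show "\<forall>L. matching F L \<longrightarrow> card L < Suc (card F)"
      using assms by (auto simp: matching_def less_Suc_eq_le intro: card_mono)
  qed
  then show ?thesis using that by (auto simp: max_matching_def)
qed

lemma matching_edge_unique:
  "\<lbrakk>matching F M; e \<in> M; f \<in> M; x \<in> e; x \<in> f\<rbrakk> \<Longrightarrow> e = f"
  by (auto simp: matching_def pairwise_def disjnt_def)

lemma finite_Union_matching:
  assumes "finite F" "\<And>e. e \<in> F \<Longrightarrow> card e = 2" "matching F M"
  shows "finite (\<Union>M)"
proof (rule finite_Union)
  show "finite M" using assms by (auto simp: matching_def intro: finite_subset)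
  show "finite e" if "e \<in> M" for e
  proof (rule card_ge_0_finite)
    have "e \<in> F" using assms(3) that by (auto simp: matching_def)
    then show "0 < card e" using assms(2) by simp
  qed
qed

lemma card_Union_matching:
  assumes "finite F" "\<And>e. e \<in> F \<Longrightarrow> card e = 2" "matching F M"
  shows "card (\<Union>M) = 2 * card M"
proof -
  have "card (\<Union>M) = sum card M"
    using assms(3) finite_Union_matching[OF assms]
    by (intro card_Union_disjoint) (auto simp: matching_def intro: finite_subset)
  also have "\<dots> = 2 * card M"
    using assms by (subst sum.cong[where h = "\<lambda>_. 2"]) (auto simp: matching_def)
  finally show ?thesis .
qed

lemma max_matching_covers_edge:
  assumes "finite F" "max_matching F M" "e \<in> F" "e \<noteq> {}"
  shows "e \<inter> \<Union>M \<noteq> {}"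
proof
  assume *: "e \<inter> \<Union>M = {}"
  have M: "matching F M" "finite M"
    using assms by (auto simp: max_matching_def matching_def intro: finite_subset)
  have "e \<notin> M" using * assms(4) by auto
  then have "card (insert e M) = Suc (card M)" using M by simp
  moreover have "matching F (insert e M)" using M assms * by (intro matching_insert)
  ultimately show False using assms(2) by (auto simp: max_matching_def)
qed

section \<open>Gallai's lemma\<close>

text \<open>
  Gallai's exchange: a matching missing \<open>b\<close> is moved towards \<open>M\<close> one edge at a time, without
  ever covering \<open>b\<close>; this can be continued because \<open>a\<close> and \<open>c\<close> stay covered but \<open>M\<close> misses both.
\<close>

lemma gallai_exchange:
  assumes fin: "finite F" and two: "\<And>e. e \<in> F \<Longrightarrow> card e = 2"
    and M: "max_matching F M" "a \<notin> \<Union>M" "c \<notin> \<Union>M" "a \<noteq> c"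
    and ab: "\<And>L. max_matching F L \<Longrightarrow> b \<notin> \<Union>L \<Longrightarrow> a \<in> \<Union>L \<and> c \<in> \<Union>L"
    and N: "max_matching F N"
  shows "b \<in> \<Union>N"
  using N
\<comment> \<open>The measure decreases as \<open>N\<close> shares more edges with
  \<open>M\<close>.\<close>
proof (induction "card F - card (M \<inter> N)" arbitrary: N rule: less_induct)
  case less
  show ?case
  proof (rule ccontr)
    assume b: "b \<notin> \<Union>N"
    note N = less.prems
    have mM: "matching F M" and mN: "matching F N"
      using M N by (auto simp: max_matching_def)
    have finM: "finite M" "finite N"
      using mM mN fin by (auto simp: matching_def intro: finite_subset)
    have "card M = card N" using M N by (auto simp: max_matching_def intro: le_antisym)
    then have eq: "card (\<Union>M) = card (\<Union>N)"
      using card_Union_matching[OF fin two] mM mN by simp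
    have finU: "finite (\<Union>M)" "finite (\<Union>N)"
      using finite_Union_matching[OF fin two] mM mN by blast+
    \<comment> \<open>\<open>M\<close> and \<open>N\<close> cover equally many vertices. As
      \<open>N\<close> covers two that \<open>M\<close> misses, \<open>M\<close> covers two that
      \<open>N\<close> misses, and one of these differs from \<open>b\<close>.\<close>
    have ac: "{a, c} \<subseteq> \<Union>N - \<Union>M" using ab[OF N b] M by auto
    have "card (\<Union>N - \<Union>M) = card (\<Union>M - \<Union>N)"
      using eq finU by (simp add: card_Diff_subset_Int Int_commute)
    moreover have "card {a, c} \<le> card (\<Union>N - \<Union>M)" using ac finU by (intro card_mono) auto
    ultimately have "2 \<le> card (\<Union>M - \<Union>N)" using M by simp
    then have "\<not> \<Union>M - \<Union>N \<subseteq> {b}"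
      using card_mono[of "{b}" "\<Union>M - \<Union>N"] by auto
    then obtain x where x: "x \<in> \<Union>M" "x \<notin> \<Union>N" "x \<noteq> b" by auto
    then obtain e where e: "e \<in> M" "x \<in> e" by auto
    have eF: "e \<in> F" using e mM by (auto simp: matching_def)
    obtain y where y: "e = {x, y}" "x \<noteq> y"
      using two[OF eF] e(2) by (auto simp: card_2_iff)
    \<comment> \<open>Otherwise \<open>e\<close> could be added to \<open>N\<close>.\<close>
    have "y \<in> \<Union>N"
      using max_matching_covers_edge[OF fin N eF] x y by auto
    then obtain f where f: "f \<in> N" "y \<in> f" by auto
    have "f \<noteq> e" using f x e by auto
    then have fM: "f \<notin> M"
      using matching_edge_unique[OF mM e(1)] f y by blast
    have eN: "e \<notin> N" using x e by auto
    \<comment> \<open>Removing \<open>f\<close> frees \<open>y\<close>, and \<open>x\<close> was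
      free already, so \<open>e\<close> fits in. The size is unchanged, and since \<open>f\<close>
      is not in \<open>M\<close> the overlap with \<open>M\<close> grows by one.\<close>
    define N' where "N' = insert e (N - {f})"
    have "y \<notin> \<Union>(N - {f})"
      using matching_edge_unique[OF mN f(1) _ f(2)] by blast
    then have "matching F N'"
      unfolding N'_def using x y eF matching_subset[OF mN]
      by (intro matching_insert) auto
    moreover have "card N' = card N"
      unfolding N'_def using eN finM card_Suc_Diff1[OF finM(2) f(1)] by simp
    ultimately have N': "max_matching F N'" using N by (auto simp: max_matching_def)
    have "M \<inter> N' = insert e (M \<inter> N)" unfolding N'_def using e fM by auto
    then have c1: "card (M \<inter> N') = Suc (card (M \<inter> N))" using eN finM by simp
    have "card (M \<inter> N') \<le> card F"
      using fin mM by (intro card_mono) (auto simp: matching_def)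
    then have "b \<in> \<Union>N'" using c1 by (intro less.hyps N') simp
    \<comment> \<open>The only vertex that \<open>N'\<close> covers and \<open>N\<close> misses is
      \<open>x\<close>, which is not \<open>b\<close>.\<close>
    moreover have "b \<noteq> y" using \<open>y \<in> \<Union>N\<close> b by auto
    ultimately show False using b x y unfolding N'_def by auto
  qed
qed

text \<open>The disjunct \<open>a = b\<close> makes the relation reflexive; a vertex missed by some
  maximum matching would otherwise not be related to itself.\<close>

definition never_both_missed :: "'a set set \<Rightarrow> 'a \<Rightarrow> 'a \<Rightarrow> bool" where
  "never_both_missed F a b \<longleftrightarrow> a = b \<or> (\<forall>L. max_matching F L \<longrightarrow> a \<in> \<Union>L \<or> b \<in> \<Union>L)"

text \<open>A maximum matching missing \<open>a\<close> and \<open>c\<close> would, by the exchange,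
  force \<open>N\<close> to cover \<open>b\<close>. The matching \<open>N\<close> is essential: a
  vertex covered by every maximum matching is related to all vertices.\<close>

lemma never_both_missed_trans:
  assumes "finite F" "\<And>e. e \<in> F \<Longrightarrow> card e = 2"
    and "max_matching F N" "b \<notin> \<Union>N"
    and "never_both_missed F a b" "never_both_missed F b c"
  shows "never_both_missed F a c"
proof (rule ccontr)
  assume n: "\<not> never_both_missed F a c"
  then obtain M where M: "max_matching F M" "a \<notin> \<Union>M" "c \<notin> \<Union>M" "a \<noteq> c"
    by (auto simp: never_both_missed_def)
  have "a \<noteq> b" "b \<noteq> c" using n assms by auto
  then have "a \<in> \<Union>L \<and> c \<in> \<Union>L" if "max_matching F L" "b \<notin> \<Union>L" for L
    using assms that unfolding never_both_missed_def by blast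
  from gallai_exchange[OF assms(1,2) M this assms(3)] assms(4) show False by blast
qed

lemma never_both_missed_edge:
  assumes "finite F" "{a, b} \<in> F"
  shows "never_both_missed F a b"
  using max_matching_covers_edge[OF assms(1) _ assms(2)] by (auto simp: never_both_missed_def)

section \<open>The complement \<open>H\<close>, with edge set \<open>nonedges V E\<close>\<close>

definition nonedges :: "'a set \<Rightarrow> 'a set set \<Rightarrow> 'a set set" where
  "nonedges V E = [V]\<^bsup>2\<^esup> - E"

lemma finite_nonedges: "finite V \<Longrightarrow> finite (nonedges V E)"
  by (simp add: nonedges_def finite_imp_finite_nsets)

lemma card_nonedge: "e \<in> nonedges V E \<Longrightarrow> card e = 2"
  by (auto simp: nonedges_def nsets_def)

lemma pair_in_nonedges_iff:
  "{a, b} \<in> nonedges V E \<longleftrightarrow> a \<in> V \<and> b \<in> V \<and> a \<noteq> b \<and> {a, b} \<notin> E"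
  by (auto simp: nonedges_def nsets_def card_insert_if split: if_splits)

lemma nonedges_mono: "U \<subseteq> V \<Longrightarrow> nonedges U E \<subseteq> nonedges V E"
  by (auto simp: nonedges_def nsets_def)

lemma degree_plus_nonneighbours:
  assumes "finite V" "v \<in> V" "\<And>v. {v, v} \<notin> E"
  shows "degree V E v + card {w \<in> V. {v, w} \<in> nonedges V E} + 1 = card V"
proof -
  let ?A = "{w \<in> V. {v, w} \<in> E}" and ?B = "{w \<in> V. {v, w} \<in> nonedges V E}"
  have "V = insert v (?A \<union> ?B)" using assms by (auto simp: pair_in_nonedges_iff)
  moreover have "v \<notin> ?A \<union> ?B" using assms by (auto simp: pair_in_nonedges_iff)
  ultimately have "card V = Suc (card (?A \<union> ?B))"
    using assms(1) by (metis (no_types, lifting) card_insert_disjoint finite_insert)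
  also have "card (?A \<union> ?B) = card ?A + card ?B"
    using assms by (intro card_Un_disjoint) (auto simp: pair_in_nonedges_iff)
  finally show ?thesis by (simp add: degree_def)
qed

text \<open>The inequality is \<open>card V - card M\<close> \<le> \<lceil>(d(v) + 1 +
  |K|)/2\<rceil>, cleared of rounding and subtraction.\<close>

lemma clique_at_min_nondegree_vertex:
  assumes fin: "finite V" and ne: "V \<noteq> {}" and loop: "\<And>v. {v, v} \<notin> E"
    and tri: "\<And>x y z. \<lbrakk>{x, y} \<in> nonedges V E; {y, z} \<in> nonedges V E\<rbrakk> \<Longrightarrow> {x, z} \<notin> nonedges V E"
    and missed: "\<And>v. v \<in> V \<Longrightarrow> \<exists>M. max_matching (nonedges V E) M \<and> v \<notin> \<Union>M"
  shows "\<exists>v\<in>V. \<exists>K\<subseteq>V. \<exists>M. clique K E \<and> v \<in> K \<and> matching (nonedges V E) M \<and>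
           2 * card V \<le> 2 * card M + degree V E v + card K + 2"
proof -
  let ?F = "nonedges V E"
  define nb where "nb v = {w \<in> V. {v, w} \<in> ?F}" for v
  note finF = finite_nonedges[OF fin, of E]
  have trans: "never_both_missed ?F a c"
    if rel: "never_both_missed ?F a b" "never_both_missed ?F b c" and b: "b \<in> V" for a b c
  proof -
    obtain N where "max_matching ?F N" "b \<notin> \<Union>N" using missed[OF b] by blast
    from never_both_missed_trans[OF finF card_nonedge this rel] show ?thesis .
  qed
  have edge: "never_both_missed ?F a b" if "{a, b} \<in> ?F" for a b
    using never_both_missed_edge[OF finF that] .
  obtain v where v: "v \<in> V" and vmin: "\<And>u. u \<in> V \<Longrightarrow> card (nb v) \<le> card (nb u)"
    using ex_has_least_nat[of "\<lambda>v. v \<in> V" _ "\<lambda>v. card (nb v)"] ne by blast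
  obtain M where M: "max_matching ?F M" and vM: "v \<notin> \<Union>M" using missed[OF v] by blast
  have mM: "matching ?F M" using M by (simp add: max_matching_def)
  define S where "S = V - \<Union>M"
  have vS: "v \<in> S" using v vM by (simp add: S_def)
  have finS: "finite S" using fin by (simp add: S_def)
  have "\<Union>M \<subseteq> V" using mM by (auto simp: matching_def nonedges_def nsets_def)
  then have cS: "card S + 2 * card M = card V"
    using card_Union_matching[OF finF card_nonedge mM] card_mono[OF fin \<open>\<Union>M \<subseteq> V\<close>]
      card_Diff_subset[OF finite_subset[OF \<open>\<Union>M \<subseteq> V\<close> fin] \<open>\<Union>M \<subseteq> V\<close>]
    by (simp add: S_def)
  have sep: "x = y" if "never_both_missed ?F x y" "x \<in> S" "y \<in> S" for x y
    using that M by (auto simp: never_both_missed_def S_def)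
  have S_clique: "clique S E"
    unfolding clique_def
  proof (intro ballI impI)
    fix x y assume xy: "x \<in> S" "y \<in> S" "x \<noteq> y"
    then show "{x, y} \<in> E"
      using sep[OF edge, of x y] by (auto simp: pair_in_nonedges_iff S_def)
  qed
  have deg: "degree V E v + card (nb v) + 1 = card V"
    unfolding nb_def by (intro degree_plus_nonneighbours fin v loop)
  have "\<exists>K\<subseteq>V. clique K E \<and> v \<in> K \<and> card (nb v) + card S \<le> card K + 1"
  \<comment> \<open>If \<open>v\<close> is isolated in \<open>H\<close>, there is no
    \<open>w\<close> to choose, but \<open>S\<close> alone is large enough.\<close>
  proof (cases "nb v = {}")
    case True
    then show ?thesis using S_clique vS by (intro exI[of _ S]) (auto simp: S_def)
  next
    case False
    then obtain w where w: "w \<in> V" "{v, w} \<in> ?F" by (auto simp: nb_def)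
    define K where "K = nb w \<union> (S - {v})"
    have rel: "never_both_missed ?F v x" if "x \<in> nb w" for x
      using that w by (intro trans[of v w x] edge) (auto simp: nb_def)
    \<comment> \<open>Every \<open>x\<close> in \<open>nb w\<close> is related to \<open>v\<close>
      through \<open>w\<close>. If \<open>x\<close> were \<open>s\<close> or
      \<open>H\<close>-adjacent to \<open>s\<close>, then \<open>v\<close> would be related to
      \<open>s\<close>, another element of \<open>S\<close>.\<close>
    have apart: "x \<noteq> s \<and> {x, s} \<in> E" if "x \<in> nb w" "s \<in> S - {v}" for x s
    proof -
      have x: "x \<in> V" using that by (simp add: nb_def)
      have n: "\<not> never_both_missed ?F v s" using sep[of v s] that vS by auto
      then have "x \<noteq> s" using rel that by blast
      moreover have "{x, s} \<notin> ?F" using n trans[OF rel edge x] that by blast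
      ultimately show ?thesis using x that by (auto simp: pair_in_nonedges_iff S_def)
    qed
    have nbw: "{x, y} \<in> E" if "x \<in> nb w" "y \<in> nb w" "x \<noteq> y" for x y
      using tri[of x w y] that by (auto simp: nb_def pair_in_nonedges_iff insert_commute)
    have "clique K E"
      unfolding clique_def
    proof (intro ballI impI)
      fix x y assume "x \<in> K" "y \<in> K" "x \<noteq> y"
      then show "{x, y} \<in> E"
        using apart[of x y] apart[of y x] nbw[of x y] S_clique
        by (auto simp: K_def clique_def insert_commute)
    qed
    moreover have "v \<in> K" using w v by (auto simp: K_def nb_def insert_commute)
    \<comment> \<open>By minimality \<open>nb w\<close> is at least as large as \<open>nb v\<close>;
      dropping \<open>v\<close> from \<open>S\<close> costs the one.\<close>
    moreover have "card K = card (nb w) + card (S - {v})"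
      unfolding K_def using apart fin finS by (intro card_Un_disjoint) (auto simp: nb_def)
    then have "card (nb v) + card S \<le> card K + 1"
      using vmin[OF w(1)] card_Suc_Diff1[OF finS vS] by simp
    moreover have "K \<subseteq> V" by (auto simp: K_def nb_def S_def)
    ultimately show ?thesis by blast
  qed
  then obtain K where K: "K \<subseteq> V" "clique K E" "v \<in> K" "card (nb v) + card S \<le> card K + 1"
    by blast
  \<comment> \<open>Substitute \<open>card (nb v)\<close> = |V| - 1 - d(v) and \<open>card S\<close>
    = |V| - 2|M|.\<close>
  have "2 * card V \<le> 2 * card M + degree V E v + card K + 2" using deg cS K(4) by linarith
  then show ?thesis using K v mM by blast
qed

section \<open>Deleting vertices covered by every maximum matching\<close>

lemma degree_mono: "finite V \<Longrightarrow> U \<subseteq> V \<Longrightarrow> degree U E v \<le> degree V E v"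
  unfolding degree_def by (rule card_mono) auto

lemma exists_clique_and_matching:
  assumes "finite V" "V \<noteq> {}" and loop: "\<And>v. {v, v} \<notin> E"
    and "\<And>x y z. \<lbrakk>{x, y} \<in> nonedges V E; {y, z} \<in> nonedges V E\<rbrakk> \<Longrightarrow> {x, z} \<notin> nonedges V E"
  shows "\<exists>v\<in>V. \<exists>K\<subseteq>V. \<exists>M. clique K E \<and> v \<in> K \<and> matching (nonedges V E) M \<and>
           2 * card V \<le> 2 * card M + degree V E v + card K + 2"
  \<comment> \<open>Nonemptiness and triangle-freeness depend on \<open>V\<close>, so they enter the
    induction and are re-established after a deletion.\<close>
  using assms(1,2,4)
proof (induction V rule: finite_psubset_induct)
  case (psubset V)
  show ?case
  proof (cases "\<forall>v\<in>V. \<exists>M. max_matching (nonedges V E) M \<and> v \<notin> \<Union>M")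
    case True
    then show ?thesis
      using psubset.prems psubset.hyps loop by (intro clique_at_min_nondegree_vertex) blast+
  next
    case False
    then obtain u where u: "u \<in> V" "\<And>M. max_matching (nonedges V E) M \<Longrightarrow> u \<in> \<Union>M" by blast
    let ?U = "V - {u}"
    obtain M where M: "max_matching (nonedges V E) M"
      using max_matching_exists finite_nonedges psubset.hyps by metis
    obtain e where e: "e \<in> nonedges V E" "u \<in> e"
      using u(2)[OF M] M by (auto simp: max_matching_def matching_def)
    have sub: "nonedges ?U E \<subseteq> nonedges V E" by (intro nonedges_mono) auto
    \<comment> \<open>The other end of \<open>e\<close> survives.\<close>
    have "?U \<noteq> {}" using e by (auto simp: nonedges_def nsets_def card_2_iff)
    then obtain v K L where *: "v \<in> ?U" "K \<subseteq> ?U" "clique K E" "v \<in> K"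
        "matching (nonedges ?U E) L" "2 * card ?U \<le> 2 * card L + degree ?U E v + card K + 2"
      using psubset.IH[of ?U] psubset.prems(2) u(1) sub by blast
    have L: "matching (nonedges V E) L" using *(5) sub by (rule matching_mono)
    \<comment> \<open>Every maximum matching covers \<open>u\<close>, so \<open>L\<close> is not
      maximum in \<open>H\<close> and \<open>M\<close> has at least one edge more, which makes up
      for the deleted vertex.\<close>
    have "u \<notin> \<Union>L" using *(5) by (auto simp: matching_def nonedges_def nsets_def)
    then have "\<not> max_matching (nonedges V E) L" using u(2) by blast
    then have "card L < card M"
      using L M unfolding max_matching_def by (meson le_trans not_le)
    moreover have "card V = Suc (card ?U)" 
      using card_Suc_Diff1[OF psubset.hyps u(1)] by (rule sym)
    moreover have "degree ?U E v \<le> degree V E v" using psubset.hyps by (intro degree_mono) auto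
    ultimately have "2 * card V \<le> 2 * card M + degree V E v + card K + 2" using *(6) by linarith
    then show ?thesis using * M unfolding max_matching_def by blast
  qed
qed

section \<open>Colourings of \<open>G\<close> from matchings of \<open>H\<close>\<close>

lemma chromatic_number_le_matching:
  assumes fin: "finite V" and loop: "\<And>v. {v, v} \<notin> E" and M: "matching (nonedges V E) M"
  shows "chromatic_number V E \<le> card V - card M"
proof -
  \<comment> \<open>The colour classes: matching edges, which are stable pairs in \<open>G\<close>,
    and singletons for the uncovered vertices.\<close>
  define P where "P = M \<union> (\<lambda>x. {x}) ` (V - \<Union>M)"
  note finF = finite_nonedges[OF fin, of E]
  have MV: "\<Union>M \<subseteq> V" using M by (auto simp: matching_def nonedges_def nsets_def)
  have finM: "finite M" using finF M by (auto simp: matching_def intro: finite_subset)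
  have "card P = card M + card ((\<lambda>x. {x}) ` (V - \<Union>M))"
    unfolding P_def using fin finM by (intro card_Un_disjoint) auto
  also have "card ((\<lambda>x. {x}) ` (V - \<Union>M)) = card (V - \<Union>M)" by (intro card_image) auto
  also have "\<dots> = card V - 2 * card M"
    using card_Union_matching[OF finF card_nonedge M] card_Diff_subset[OF finite_subset[OF MV fin] MV]
    by simp
  finally have cP: "card P = card V - card M"
    using card_Union_matching[OF finF card_nonedge M] card_mono[OF fin MV] by simp
  have "finite P" using fin finM by (simp add: P_def)
  then obtain h where h: "bij_betw h P {..<card P}"
    by (metis atLeast0LessThan ex_bij_betw_finite_nat)
  have "\<forall>x\<in>V. \<exists>B\<in>P. x \<in> B" by (auto simp: P_def)
  then obtain B where B: "\<And>x. x \<in> V \<Longrightarrow> B x \<in> P \<and> x \<in> B x" by metis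
  have "proper_coloring V E (card P) (h \<circ> B)"
    unfolding proper_coloring_def
  proof (intro conjI ballI impI)
    show "(h \<circ> B) ` V \<subseteq> {..<card P}" using B bij_betwE[OF h] by auto
  next
    fix u v assume uv: "u \<in> V" "v \<in> V" "{u, v} \<in> E"
    then have ne: "u \<noteq> v" using loop by auto
    show "(h \<circ> B) u \<noteq> (h \<circ> B) v"
    proof
      assume "(h \<circ> B) u = (h \<circ> B) v"
      then have "B u = B v" using h B uv by (auto simp: bij_betw_def dest: inj_onD)
      then have uvB: "u \<in> B u" "v \<in> B u" "B u \<in> P" using B uv by metis+
      \<comment> \<open>A class with two different vertices is no singleton, so it comes from
        \<open>M\<close>.\<close>
      then have "B u \<in> nonedges V E" using ne M by (auto simp: P_def matching_def)
      moreover from this have "B u = {u, v}" using uvB ne card_nonedge by (fastforce simp: card_2_iff)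
      ultimately show False using uv by (simp add: nonedges_def)
    qed
  qed
  then show ?thesis unfolding chromatic_number_def cP[symmetric] by (intro Least_le) blast
qed

theorem theorem2p4:
  fixes V :: "'a set" and E :: "'a set set"
  assumes "fin_sgraph V E"
    and "stability_number V E \<le> 2"
  shows "chromatic_number V E \<le> gamma_local V E"
proof (cases "V = {}")
  case True
  then have "proper_coloring V E 0 (\<lambda>_. 0)" by (simp add: proper_coloring_def)
  then have "chromatic_number V E = 0" unfolding chromatic_number_def by (intro Least_eq_0) blast
  then show ?thesis by simp
next
  case False
  have fin: "finite V" and E: "E \<subseteq> [V]\<^bsup>2\<^esup>" using assms(1) by (auto simp: fin_sgraph_def)
  have loop: "{v, v} \<notin> E" for v using E by (auto simp: nsets_def)
  have tri: "{x, z} \<notin> nonedges V E" if "{x, y} \<in> nonedges V E" "{y, z} \<in> nonedges V E" for x y z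
  proof
    assume "{x, z} \<in> nonedges V E"
    \<comment> \<open>A triangle of \<open>H\<close> is a stable set of size 3 in
      \<open>G\<close>.\<close>
    with that have S: "{x, y, z} \<subseteq> V" "indep {x, y, z} E" and "card {x, y, z} = 3"
      by (auto simp: pair_in_nonedges_iff indep_def insert_commute)
    have "card {x, y, z} \<le> stability_number V E"
      unfolding stability_number_def using fin S by (intro Max_ge) auto
    with \<open>card {x, y, z} = 3\<close> assms(2) show False by simp
  qed
  have "\<exists>v\<in>V. \<exists>K\<subseteq>V. \<exists>M. clique K E \<and> v \<in> K \<and> matching (nonedges V E) M \<and>
          2 * card V \<le> 2 * card M + degree V E v + card K + 2"
    by (rule exists_clique_and_matching[OF fin False loop]) (rule tri)
  then obtain v K M where v: "v \<in> V" "K \<subseteq> V" "clique K E" "v \<in> K" "matching (nonedges V E) M"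
    and le: "2 * card V \<le> 2 * card M + degree V E v + card K + 2"
    by blast
  let ?g = "\<lambda>v. nat \<lceil>(1/2 :: real) * (real (degree V E v) + 1 + real (clique_number_at V E v))\<rceil>"
  have K: "card K \<le> clique_number_at V E v"
    unfolding clique_number_at_def using fin v by (intro Max_ge) auto
  have chi: "chromatic_number V E \<le> card V - card M"
    by (intro chromatic_number_le_matching fin loop v)
  have "int (card V - card M) \<le> \<lceil>(1/2 :: real) * (real (degree V E v) + 1 + real (clique_number_at V E v))\<rceil>"
  proof -
    have "2 * (card V - card M) \<le> degree V E v + clique_number_at V E v + 2"
      using le K by linarith
    then have "2 * real (card V - card M) \<le> real (degree V E v) + real (clique_number_at V E v) + 2"
      by linarith
    \<comment> \<open>For an integer n, n \<le> \<lceil>x\<rceil> means n - 1 < x. This strictness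
      absorbs the gap between the 2 here and the 1 in the formula.\<close>
    then show ?thesis unfolding le_ceiling_iff by simp
  qed
  then have "card V - card M \<le> ?g v" by linarith
  also have "\<dots> \<le> gamma_local V E"
    unfolding gamma_local_def using fin v by (intro cSUP_upper bdd_above_finite) auto
  finally show ?thesis using chi by linarith
qed

end
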